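(* Suppose $(\Omega_n,z_n)\in\mathbb{X}_{d,0}$, $A_n\in\mathrm{Aff}(\mathbb{C}^d)$, and $B_n\in\mathrm{Aff}(\mathbb{C}^d)$ ($n\in\mathbb{N}$) are such that $$\lim_{n\to\infty}A_n(\Omega_n,z_n)=(U_1,u_1)\quad\text{and}\quad\lim_{n\to\infty}B_n(\Omega_n,z_n)=(U_2,u_2)$$ in $\mathbb{X}_{d,0}$. Then there exist $n_j\to\infty$ such that $B_{n_j}A_{n_j}^{-1}$ converges to some $T\in\mathrm{Aff}(\mathbb{C}^d)$ and $T(U_1,u_1)=(U_2,u_2)$.
   Context: A convex domain in $\mathbb{C}^d$ is $\mathbb{C}$-properly convex if it contains no entire complex affine line. $\mathbb{X}_d$ is the set of all non-empty $\mathbb{C}$-properly convex domains in $\mathbb{C}^d$, with the local Hausdorff topology: $\Omega_n\to\Omega$ in $\mathbb{X}_d$ if there is $R_0\ge0$ such that for all $R\ge R_0$ the Hausdorff distance between $\overline{\Omega}_n\cap\overline{B(0;R)}$ and $\overline{\Omega}\cap\overline{B(0;R)}$ tends to $0$, where $B(0;R)$ is the Euclidean ball (the Hausdorff distance between the empty set and a non-empty set is $\infty$). $\mathbb{X}_{d,0}$ is the set of pairs $(\Omega,z)$ with $\Omega\in\mathbb{X}_d$ and $z\in\Omega$; $(\Omega_n,z_n)\to(\Omega,z)$ in $\mathbb{X}_{d,0}$ means $\Omega_n\to\Omega$ in $\mathbb{X}_d$ and $z_n\to z$ in $\mathbb{C}^d$. $\mathrm{Aff}(\mathbb{C}^d)$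 is the group of complex affine automorphisms of $\mathbb{C}^d$ with its usual topology, and $A(\Omega,z)=(A\Omega,Az)$. *)

theory Defs
  imports "HOL-Analysis.Analysis"
begin

text \<open>The space $\mathbb{C}^d$ is the type \<open>complex ^ 'd\<close> with \<open>d = CARD('d) \<ge> 1\<close>; its library norm is the
  Euclidean one, and \<open>*s\<close> is multiplication by complex scalars.\<close>

definition C_properly_convex :: "(complex ^ 'd) set \<Rightarrow> bool" where
  "C_properly_convex \<Omega> \<longleftrightarrow>
     convex \<Omega> \<and> \<not> (\<exists>a v. v \<noteq> 0 \<and> range (\<lambda>t::complex. a + t *s v) \<subseteq> \<Omega>)"

definition XX :: "(complex ^ 'd) set set" where
  "XX = {\<Omega>. \<Omega> \<noteq> {} \<and> open \<Omega> \<and> connected \<Omega> \<and> C_properly_convex \<Omega>}"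

text \<open>Since suprema and infima are taken in \<^typ>\<open>ennreal\<close>, the distance between the empty set and a
  non-empty set is \<open>\<infinity>\<close>, and the distance of the empty set to itself is \<open>0\<close>.\<close>

definition hausdorff_dist :: "'a::metric_space set \<Rightarrow> 'a set \<Rightarrow> ennreal" where
  "hausdorff_dist A B =
     max (SUP a\<in>A. INF b\<in>B. ennreal (dist a b)) (SUP b\<in>B. INF a\<in>A. ennreal (dist a b))"

lemma hausdorff_dist_empty:
  "hausdorff_dist {} {} = 0"
  "A \<noteq> {} \<Longrightarrow> hausdorff_dist {} A = \<infinity>"
  "A \<noteq> {} \<Longrightarrow> hausdorff_dist A {} = \<infinity>"
  by (auto simp: hausdorff_dist_def bot_ennreal max_def)

definition tendsto_XX :: "(nat \<Rightarrow> (complex ^ 'd) set) \<Rightarrow> (complex ^ 'd) set \<Rightarrow> bool" where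
  "tendsto_XX \<Omega> U \<longleftrightarrow>
     (\<forall>n. \<Omega> n \<in> XX) \<and> U \<in> XX \<and>
     (\<exists>R\<^sub>0\<ge>0. \<forall>R\<ge>R\<^sub>0.
        (\<lambda>n. hausdorff_dist (closure (\<Omega> n) \<inter> closure (ball 0 R)) (closure U \<inter> closure (ball 0 R)))
          \<longlonglongrightarrow> 0)"

definition XX0 :: "((complex ^ 'd) set \<times> (complex ^ 'd)) set" where
  "XX0 = {(\<Omega>, z). \<Omega> \<in> XX \<and> z \<in> \<Omega>}"

definition tendsto_XX0 ::
  "(nat \<Rightarrow> (complex ^ 'd) set \<times> (complex ^ 'd)) \<Rightarrow> (complex ^ 'd) set \<times> (complex ^ 'd) \<Rightarrow> bool" where
  "tendsto_XX0 p q \<longleftrightarrow>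
     (\<forall>n. p n \<in> XX0) \<and> q \<in> XX0 \<and>
     tendsto_XX (\<lambda>n. fst (p n)) (fst q) \<and> (\<lambda>n. snd (p n)) \<longlonglongrightarrow> snd q"

definition Aff :: "(complex ^ 'd \<Rightarrow> complex ^ 'd) set" where
  "Aff = {(\<lambda>z. M *v z + b) | M b. invertible M}"

definition aff_coords :: "(complex ^ 'd \<Rightarrow> complex ^ 'd) \<Rightarrow> (complex ^ 'd ^ 'd) \<times> (complex ^ 'd)" where
  "aff_coords T = (matrix (\<lambda>z. T z - T 0), T 0)"

lemma aff_coords_affine: "aff_coords (\<lambda>z. M *v z + b) = (M, b)"
  by (simp add: aff_coords_def)

text \<open>The usual topology of $\mathrm{Aff}(\mathbb{C}^d)$, induced by its identification with
  $\mathrm{GL}_d(\mathbb{C}) \times \mathbb{C}^d$.\<close>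

definition Aff_topology :: "(complex ^ 'd \<Rightarrow> complex ^ 'd) topology" where
  "Aff_topology = pullback_topology Aff aff_coords euclidean"

lemma topspace_Aff_topology: "topspace Aff_topology = Aff"
  by (simp add: Aff_topology_def topspace_pullback_topology)

definition aff_act ::
  "(complex ^ 'd \<Rightarrow> complex ^ 'd) \<Rightarrow> (complex ^ 'd) set \<times> (complex ^ 'd) \<Rightarrow> (complex ^ 'd) set \<times> (complex ^ 'd)"
  where "aff_act A p = (A ` fst p, A (snd p))"

end

theory Submission
  imports Defs
begin

text \<open>Put \<open>T n = B n \<circ> inv (A n)\<close>. A fixed ball around \<open>u\<^sub>1\<close> is eventually contained in \<open>A n ` \<Omega> n\<close>.
  If the linear parts of \<open>T n\<close> were unbounded, the images of discs in this ball would be discs in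
  \<open>B n ` \<Omega> n\<close> with centres converging to \<open>u\<^sub>2\<close> and radii tending to infinity along a subsequence, so
  \<open>U\<^sub>2\<close> would contain a complex line through \<open>u\<^sub>2\<close>. By symmetry the inverses are bounded too, so a
  subsequence converges to some \<open>T\<close> in the affine group; it maps \<open>U\<^sub>1\<close> into
  \<open>interior (closure U\<^sub>2) = U\<^sub>2\<close>, and \<open>inv T\<close> maps \<open>U\<^sub>2\<close> into \<open>U\<^sub>1\<close>.\<close>

section \<open>Local Hausdorff convergence\<close>

lemma hausdorff_dist_commute: "hausdorff_dist A B = hausdorff_dist B A"
  by (simp add: hausdorff_dist_def max.commute dist_commute)

lemma hausdorff_dist_lessD:
  assumes "hausdorff_dist A B < ennreal e" and "a \<in> A"
  obtains b where "b \<in> B" "dist a b < e"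
proof -
  have "(SUP a\<in>A. INF b\<in>B. ennreal (dist a b)) < ennreal e"
    using assms(1) by (simp add: hausdorff_dist_def)
  then have "(INF b\<in>B. ennreal (dist a b)) < ennreal e"
    using assms(2) by (meson SUP_upper le_less_trans)
  then obtain b where b: "b \<in> B" "ennreal (dist a b) < ennreal e"
    by (auto simp: INF_less_iff)
  then show ?thesis
    using that by (simp add: ennreal_less_iff)
qed

lemma tendsto_XX_hausdorff_less:
  assumes "tendsto_XX V U" and "e > 0"
  obtains R' where "R' \<ge> R"
    "\<forall>\<^sub>F n in sequentially. hausdorff_dist (closure (V n) \<inter> cball 0 R') (closure U \<inter> cball 0 R') < ennreal e"
proof -
  obtain R0 where R0: "\<And>R. R \<ge> R0 \<Longrightarrow>
        (\<lambda>n. hausdorff_dist (closure (V n) \<inter> closure (ball 0 R)) (closure U \<inter> closure (ball 0 R)))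
          \<longlonglongrightarrow> 0"
    using assms(1) unfolding tendsto_XX_def by blast
  define R' where "R' = max R0 (max R 1)"
  have "(\<lambda>n. hausdorff_dist (closure (V n) \<inter> cball 0 R') (closure U \<inter> cball 0 R')) \<longlonglongrightarrow> 0"
    using R0[of R'] by (simp add: R'_def)
  then have "\<forall>\<^sub>F n in sequentially. hausdorff_dist (closure (V n) \<inter> cball 0 R') (closure U \<inter> cball 0 R') < ennreal e"
    using assms(2) by (intro order_tendstoD(2)) auto
  then show ?thesis
    using that[of R'] by (simp add: R'_def)
qed

lemma tendsto_XX_inner_approx:
  assumes "tendsto_XX V U" and "e > 0"
  shows "\<forall>\<^sub>F n in sequentially. \<forall>x\<in>closure U \<inter> cball 0 R. \<exists>y\<in>V n. dist x y < e"
proof -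
  obtain R' where R': "R' \<ge> R"
    and ev: "\<forall>\<^sub>F n in sequentially. hausdorff_dist (closure (V n) \<inter> cball 0 R') (closure U \<inter> cball 0 R') < ennreal (e/2)"
    using tendsto_XX_hausdorff_less[OF assms(1), of "e/2" R] assms(2) by auto
  show ?thesis
    using ev
  proof eventually_elim
    case (elim n)
    show ?case
    proof
      fix x assume "x \<in> closure U \<inter> cball 0 R"
      then have "x \<in> closure U \<inter> cball 0 R'" using R' by auto
      then obtain y where y: "y \<in> closure (V n)" "dist x y < e/2"
        using elim by (metis hausdorff_dist_commute hausdorff_dist_lessD IntE)
      obtain y' where "y' \<in> V n" "dist y' y < e/2"
        using y(1) assms(2) closure_approachable half_gt_zero by blast
      then show "\<exists>y\<in>V n. dist x y < e"
        using y(2) dist_triangle_half_r[of y x e y'] by (auto simp: dist_commute)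
    qed
  qed
qed

lemma tendsto_XX_outer_approx:
  assumes "tendsto_XX V U" and "e > 0"
  shows "\<forall>\<^sub>F n in sequentially. \<forall>x\<in>V n \<inter> cball 0 R. \<exists>y\<in>closure U. dist x y < e"
proof -
  obtain R' where R': "R' \<ge> R"
    and ev: "\<forall>\<^sub>F n in sequentially. hausdorff_dist (closure (V n) \<inter> cball 0 R') (closure U \<inter> cball 0 R') < ennreal e"
    using tendsto_XX_hausdorff_less[OF assms] by blast
  show ?thesis
    using ev
  proof eventually_elim
    case (elim n)
    show ?case
    proof
      fix x assume "x \<in> V n \<inter> cball 0 R"
      then have "x \<in> closure (V n) \<inter> cball 0 R'" using R' closure_subset by auto
      then show "\<exists>y\<in>closure U. dist x y < e"
        using elim by (metis hausdorff_dist_lessD IntE)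
    qed
  qed
qed

lemma tendsto_XX_limit_in_closure:
  assumes V: "tendsto_XX V U" and r: "filterlim r at_top sequentially"
    and y: "\<forall>\<^sub>F j in sequentially. y j \<in> V (r j)" and lim: "y \<longlonglongrightarrow> l"
  shows "l \<in> closure U"
proof (unfold closure_approachable, intro allI impI)
  fix e :: real assume e: "e > 0"
  obtain K where K: "\<And>j. norm (y j) \<le> K"
    using convergent_imp_bounded[OF lim] by (auto simp: bounded_iff)
  have 1: "\<forall>\<^sub>F j in sequentially. \<forall>x\<in>V (r j) \<inter> cball 0 K. \<exists>z\<in>closure U. dist x z < e/3"
    using e r by (intro eventually_compose_filterlim[OF tendsto_XX_outer_approx[OF V]]) auto
  have 2: "\<forall>\<^sub>F j in sequentially. dist (y j) l < e/3"
    using lim e by (intro tendstoD) auto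
  have "\<forall>\<^sub>F j in sequentially. \<exists>z\<in>closure U. dist z l < 2*e/3"
    using 1 2 y
  proof eventually_elim
    case (elim j)
    then have "y j \<in> V (r j) \<inter> cball 0 K" using K by simp
    then obtain z where "z \<in> closure U" "dist (y j) z < e/3" using elim(1) by blast
    then show ?case
      using elim(2) dist_triangle3[of z l "y j"] by (intro bexI[of _ z]) auto
  qed
  then obtain z where z: "z \<in> closure U" "dist z l < 2*e/3"
    using eventually_happens' trivial_limit_sequentially by blast
  obtain z' where "z' \<in> U" "dist z' z < e/3"
    using z(1) e by (meson closure_approachable divide_pos_pos zero_less_numeral)
  then show "\<exists>y\<in>U. dist y l < e"
    using z(2) dist_triangle[of z' l z] by (intro bexI[of _ z']) auto
qed

text \<open>If \<open>p\<close> near \<open>u\<close> is missed by the convex set \<open>V n\<close>, moving from \<open>p\<close> along the normal of a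
  separating hyperplane gives a point of \<open>U\<close> far away from \<open>V n\<close>.\<close>

lemma tendsto_XX_eventually_ball:
  assumes V: "tendsto_XX V U" and u: "u \<in> U"
  obtains s where "s > 0" "\<forall>\<^sub>F n in sequentially. ball u s \<subseteq> V n"
proof -
  have "open U" using V by (auto simp: tendsto_XX_def XX_def)
  then obtain d where d: "d > 0" "cball u d \<subseteq> U"
    using u open_contains_cball by blast
  define s where "s = d/3"
  have s: "s > 0" "cball u (3 * s) \<subseteq> U" using d by (auto simp: s_def)
  have "\<forall>\<^sub>F n in sequentially. \<forall>x\<in>closure U \<inter> cball 0 (norm u + 3 * s). \<exists>y\<in>V n. dist x y < s"
    using tendsto_XX_inner_approx[OF V s(1)] .
  then have "\<forall>\<^sub>F n in sequentially. ball u s \<subseteq> V n"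
  proof eventually_elim
    case (elim n)
    have near: "\<exists>y\<in>V n. dist x y < s" if "x \<in> cball u (3 * s)" for x
    proof -
      have "norm x \<le> norm u + 3 * s"
        using that norm_triangle_ineq2[of x u] by (simp add: dist_norm norm_minus_commute)
      moreover have "x \<in> closure U" using that s closure_subset by blast
      ultimately show ?thesis using elim by auto
    qed
    have conv: "convex (V n)" using V by (auto simp: tendsto_XX_def XX_def C_properly_convex_def)
    show ?case
    proof
      fix p assume p: "p \<in> ball u s"
      show "p \<in> V n"
      proof (rule ccontr)
        assume "p \<notin> V n"
        moreover have "V n \<noteq> {}" using near[of u] s by auto
        ultimately obtain a b where a: "a \<noteq> 0" "a \<bullet> p \<ge> b" "\<And>y. y \<in> V n \<Longrightarrow> a \<bullet> y \<le> b"
          using separating_hyperplane_sets[of "V n" "{p}"] conv by auto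
        define q where "q = p + (2 * s / norm a) *\<^sub>R a"
        have "dist u q \<le> dist u p + dist p q" by (rule dist_triangle)
        also have "dist p q = 2 * s" using a(1) s by (simp add: q_def dist_norm)
        finally have "q \<in> cball u (3 * s)" using p by simp
        then obtain y where y: "y \<in> V n" "dist q y < s" using near by blast
        have "a \<bullet> q = a \<bullet> p + 2 * s * norm a"
          using a(1) by (simp add: q_def inner_add_right dot_square_norm power2_eq_square)
        then have "2 * s * norm a \<le> a \<bullet> (q - y)"
          using a(2) a(3)[OF y(1)] by (simp add: inner_diff_right)
        also have "\<dots> \<le> norm a * norm (q - y)" by (rule norm_cauchy_schwarz)
        also have "\<dots> < norm a * (2 * s)"
          using y(2) a(1) s(1) by (intro mult_strict_left_mono) (auto simp: dist_norm)
        finally show False by simp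
      qed
    qed
  qed
  then show ?thesis using s(1) that by blast
qed

lemma open_convex_interior_closure:
  fixes U :: "'a::euclidean_space set"
  assumes "open U" "convex U"
  shows "interior (closure U) = U"
  using assms by (simp add: convex_interior_closure interior_open)

section \<open>Complex scalars and matrices\<close>

lemma norm_vector_scalar_mult: "norm (c *s x) = norm c * norm (x :: complex ^ 'd)"
proof -
  have "norm (c *s x) = sqrt ((norm c)\<^sup>2 * (\<Sum>i\<in>UNIV. (norm (x$i))\<^sup>2))"
    by (simp add: norm_vec_def L2_set_def norm_mult power_mult_distrib sum_distrib_left)
  also have "\<dots> = norm c * norm x"
    by (simp add: norm_vec_def L2_set_def real_sqrt_mult)
  finally show ?thesis .
qed

lemma scaleR_eq_vector_scalar_mult: "a *\<^sub>R x = complex_of_real a *s (x :: complex ^ 'd)"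
  by (simp add: vec_eq_iff scaleR_conv_of_real[where 'a = complex])

lemma tendsto_vector_scalar_mult [tendsto_intros]:
  fixes f :: "'a \<Rightarrow> complex ^ 'd"
  assumes "(c \<longlongrightarrow> a) F" "(f \<longlongrightarrow> x) F"
  shows "((\<lambda>n. c n *s f n) \<longlongrightarrow> a *s x) F"
  by (rule vec_tendstoI) (auto intro!: tendsto_intros assms)

lemma tendsto_matrix_vector_mult [tendsto_intros]:
  fixes M :: "'a \<Rightarrow> complex ^ 'd ^ 'e"
  assumes "(M \<longlongrightarrow> L) F" "(f \<longlongrightarrow> x) F"
  shows "((\<lambda>n. M n *v f n) \<longlongrightarrow> L *v x) F"
  unfolding matrix_vector_mult_def
  by (rule vec_tendstoI) (auto intro!: tendsto_intros assms)

lemma tendsto_matrix_matrix_mult [tendsto_intros]: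
  fixes M :: "'a \<Rightarrow> complex ^ 'd ^ 'e" and N :: "'a \<Rightarrow> complex ^ 'f ^ 'd"
  assumes "(M \<longlongrightarrow> L) F" "(N \<longlongrightarrow> K) F"
  shows "((\<lambda>n. M n ** N n) \<longlongrightarrow> L ** K) F"
  unfolding matrix_matrix_mult_def
  by (intro vec_tendstoI) (auto intro!: tendsto_intros assms)

lemma norm_matrix_le:
  fixes M :: "complex ^ 'd ^ 'e" and C :: real
  assumes "\<And>x. norm (M *v x) \<le> C * norm x"
  shows "norm M \<le> CARD('e) * (CARD('d) * C)"
proof -
  have entry: "norm (M $ i $ j) \<le> C" for i j
  proof -
    have "M $ i $ j = (M *v axis j 1) $ i"
      by (simp add: matrix_vector_mult_def axis_def if_distrib[of "(*) _"] cong: if_cong)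
    also have "norm \<dots> \<le> norm (M *v axis j 1)" by (rule Finite_Cartesian_Product.norm_nth_le)
    also have "\<dots> \<le> C * norm (axis j (1::complex) :: complex ^ 'd)" by (rule assms)
    finally show ?thesis by (simp add: norm_axis_1)
  qed
  have "norm (M $ i) \<le> CARD('d) * C" for i
  proof -
    have "norm (M $ i) \<le> (\<Sum>j\<in>UNIV. norm (M $ i $ j))"
      unfolding norm_vec_def[of "M $ i"] by (rule L2_set_le_sum) simp
    also have "\<dots> \<le> (\<Sum>j\<in>(UNIV::'d set). C)" by (intro sum_mono entry)
    finally show ?thesis by simp
  qed
  moreover have "norm M \<le> (\<Sum>i\<in>UNIV. norm (M $ i))"
    unfolding norm_vec_def[of M] by (rule L2_set_le_sum) simp
  ultimately have "norm M \<le> (\<Sum>i\<in>(UNIV::'e set). CARD('d) * C)"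
    by (meson order_trans sum_mono)
  then show ?thesis by simp
qed

section \<open>Compactness of the affine maps\<close>

lemma no_complex_line_in_closure:
  assumes "U \<in> XX" "u \<in> U" "f \<noteq> 0"
  shows "\<exists>t. u + t *s f \<notin> closure U"
proof (rule ccontr)
  assume "\<not> ?thesis"
  then have cl: "u + t *s f \<in> closure U" for t by blast
  have U: "open U" "convex U" using assms by (auto simp: XX_def C_properly_convex_def)
  have "u + t *s f \<in> U" for t
  proof -
    have "u + (2 * t) *s f - (1/2) *\<^sub>R (u + (2 * t) *s f - u) \<in> interior U"
      using U assms(2) cl[of "2*t"] by (intro mem_interior_closure_convex_shrink) (auto simp: interior_open)
    moreover have "u + (2 * t) *s f - (1/2) *\<^sub>R (u + (2 * t) *s f - u) = u + t *s f"
      by (simp add: vec_eq_iff scaleR_conv_of_real[where 'a = complex])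
    ultimately show ?thesis using interior_subset[of U] by (simp only: subset_iff)
  qed
  then have "range (\<lambda>t. u + t *s f) \<subseteq> U" by blast
  then show False using assms by (auto simp: XX_def C_properly_convex_def)
qed

lemma affine_maps_eventually_bounded:
  fixes M :: "nat \<Rightarrow> complex ^ 'd ^ 'd"
  assumes V: "tendsto_XX V U1" and W: "tendsto_XX W U2"
    and v: "v \<longlonglongrightarrow> u1" "u1 \<in> U1" and w: "w \<longlonglongrightarrow> u2" "u2 \<in> U2"
    and maps: "\<And>n x. x \<in> V n \<Longrightarrow> w n + M n *v (x - v n) \<in> W n"
  shows "\<exists>C N. \<forall>n\<ge>N. \<forall>x. norm (M n *v x) \<le> C * norm x"
proof (rule ccontr)
  assume "\<not> ?thesis"
  then have "\<exists>n\<ge>k. \<exists>x. norm (M n *v x) > real k * norm x" for k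
    by (meson not_le)
  then obtain r x where r: "\<And>k. r k \<ge> k" and x: "\<And>k. norm (M (r k) *v x k) > real k * norm (x k)"
    by metis
  have xnz: "x k \<noteq> 0" for k using x[of k] by auto
  define e where "e k = (1 / norm (x k)) *\<^sub>R x k" for k
  have norm_e: "norm (e k) = 1" for k using xnz by (simp add: e_def)
  define m where "m k = norm (M (r k) *v e k)" for k
  have m: "m k > real k" for k
  proof -
    have "M (r k) *v e k = complex_of_real (1 / norm (x k)) *s (M (r k) *v x k)"
      by (simp add: e_def scaleR_eq_vector_scalar_mult vector_scalar_commute)
    then have "m k = norm (M (r k) *v x k) / norm (x k)"
      by (simp add: m_def norm_vector_scalar_mult norm_divide)
    then show ?thesis using x[of k] xnz[of k] by (simp add: pos_less_divide_eq)
  qed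
  then have mpos: "m k > 0" for k using of_nat_0_le_iff le_less_trans by metis
  define f where "f k = (1 / m k) *\<^sub>R (M (r k) *v e k)" for k
  have "f k \<in> sphere 0 1" for k using mpos[of k] by (simp add: f_def) (simp add: m_def)
  then obtain g \<rho> where g: "g \<in> sphere 0 1" and \<rho>: "strict_mono \<rho>" and lim: "(f \<circ> \<rho>) \<longlonglongrightarrow> g"
    using compact_sphere[of "0::complex^'d" 1] unfolding compact_def by metis
  define \<sigma> where "\<sigma> = r \<circ> \<rho>"
  have \<sigma>: "filterlim \<sigma> at_top sequentially"
    unfolding \<sigma>_def comp_def
    by (rule filterlim_at_top_mono[OF filterlim_subseq[OF \<rho>]]) (use r in auto)
  obtain s where s: "s > 0" "\<forall>\<^sub>F n in sequentially. ball u1 s \<subseteq> V n"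
    using tendsto_XX_eventually_ball[OF V v(2)] .
  have "u2 + t *s g \<in> closure U2" for t
  proof (rule tendsto_XX_limit_in_closure[OF W \<sigma>])
    show "(\<lambda>j. w (\<sigma> j) + t *s f (\<rho> j)) \<longlonglongrightarrow> u2 + t *s g"
      using lim filterlim_compose[OF w(1) \<sigma>] by (auto intro!: tendsto_intros simp: comp_def)
    have 1: "\<forall>\<^sub>F j in sequentially. ball u1 s \<subseteq> V (\<sigma> j)"
      using s(2) \<sigma> by (rule eventually_compose_filterlim)
    have 2: "\<forall>\<^sub>F j in sequentially. dist (v (\<sigma> j)) u1 < s/2"
      using filterlim_compose[OF v(1) \<sigma>] s(1) by (intro tendstoD) auto
    have "filterlim (\<lambda>j. real (\<rho> j)) at_top sequentially"
      using filterlim_compose[OF filterlim_real_sequentially filterlim_subseq[OF \<rho>]] .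
    then have 3: "\<forall>\<^sub>F j in sequentially. real (\<rho> j) > 2 * norm t / s"
      by (simp add: filterlim_at_top_dense)
    show "\<forall>\<^sub>F j in sequentially. w (\<sigma> j) + t *s f (\<rho> j) \<in> W (\<sigma> j)"
      using 1 2 3
    proof eventually_elim
      case (elim j)
      define c where "c = t / complex_of_real (m (\<rho> j))"
      have "m (\<rho> j) > 2 * norm t / s" using elim(3) m[of "\<rho> j"] by linarith
      then have c: "norm c < s/2"
        using mpos[of "\<rho> j"] s(1) by (simp add: c_def norm_divide field_simps)
      define y where "y = v (\<sigma> j) + c *s e (\<rho> j)"
      have "dist y u1 \<le> dist y (v (\<sigma> j)) + dist (v (\<sigma> j)) u1" by (rule dist_triangle)
      also have "dist y (v (\<sigma> j)) = norm c"
        by (simp add: y_def dist_norm norm_vector_scalar_mult norm_e)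
      finally have "y \<in> V (\<sigma> j)" using elim c by (auto simp: dist_commute)
      then have "w (\<sigma> j) + M (\<sigma> j) *v (y - v (\<sigma> j)) \<in> W (\<sigma> j)" by (rule maps)
      moreover have "M (\<sigma> j) *v (y - v (\<sigma> j)) = t *s f (\<rho> j)"
        by (simp add: y_def f_def c_def \<sigma>_def vector_scalar_commute scaleR_eq_vector_scalar_mult
            vector_smult_assoc)
      ultimately show ?case by simp
    qed
  qed
  moreover have "U2 \<in> XX" "g \<noteq> 0" using W g by (auto simp: tendsto_XX_def)
  ultimately show False
    using no_complex_line_in_closure w(2) by blast
qed

lemma limit_affine_map_image_subset:
  fixes M :: "nat \<Rightarrow> complex ^ 'd ^ 'd"
  assumes V: "tendsto_XX V U1" and W: "tendsto_XX W U2" and r: "filterlim r at_top sequentially"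
    and v: "v \<longlonglongrightarrow> u1" and w: "w \<longlonglongrightarrow> u2"
    and maps: "\<And>n x. x \<in> V n \<Longrightarrow> w n + M n *v (x - v n) \<in> W n"
    and M: "(\<lambda>j. M (r j)) \<longlonglongrightarrow> L" and L': "L' ** L = mat 1" "L ** L' = mat 1"
  shows "(\<lambda>x. u2 + L *v (x - u1)) ` U1 \<subseteq> U2"
proof -
  let ?T = "\<lambda>x. u2 + L *v (x - u1)" and ?S = "\<lambda>y. u1 + L' *v (y - u2)"
  have U: "open U1" "open U2" "convex U2"
    using V W by (auto simp: tendsto_XX_def XX_def C_properly_convex_def)
  have cl: "?T x \<in> closure U2" if x: "x \<in> U1" for x
  proof (rule tendsto_XX_limit_in_closure[OF W r])
    show "(\<lambda>j. w (r j) + M (r j) *v (x - v (r j))) \<longlonglongrightarrow> ?T x"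
      using filterlim_compose[OF v r] filterlim_compose[OF w r] M by (auto intro!: tendsto_intros)
    obtain s where s: "s > 0" "\<forall>\<^sub>F n in sequentially. ball x s \<subseteq> V n"
      using tendsto_XX_eventually_ball[OF V x] .
    have "\<forall>\<^sub>F n in sequentially. w n + M n *v (x - v n) \<in> W n"
      using s(2) by eventually_elim (use s(1) in \<open>auto intro!: maps\<close>)
    then show "\<forall>\<^sub>F j in sequentially. w (r j) + M (r j) *v (x - v (r j)) \<in> W (r j)"
      using r by (rule eventually_compose_filterlim)
  qed
  have ST: "?S (?T x) = x" and TS: "?T (?S x) = x" for x
    using L' by (simp_all add: matrix_vector_mul_assoc)
  have "?T ` U1 = ?S -` U1"
  proof (intro equalityI subsetI)
    fix y assume "y \<in> ?S -` U1"
    then have "?S y \<in> U1" by simp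
    then show "y \<in> ?T ` U1" by (intro image_eqI[of _ _ "?S y"]) (simp only: TS)
  qed (auto simp only: ST vimage_eq)
  moreover have "continuous_on UNIV ?S"
    by (auto simp: continuous_on_def intro!: tendsto_intros)
  ultimately have "open (?T ` U1)" using U(1) by (simp add: open_vimage)
  then have "?T ` U1 \<subseteq> interior (closure U2)"
    using cl by (intro interior_maximal) auto
  then show ?thesis using U by (simp add: open_convex_interior_closure)
qed

section \<open>The affine group\<close>

lemma limitin_Aff_topology:
  fixes M :: "nat \<Rightarrow> complex ^ 'd ^ 'd"
  assumes "\<And>j. invertible (M j)" "invertible L"
    and "M \<longlonglongrightarrow> L" "b \<longlonglongrightarrow> c"
  shows "limitin Aff_topology (\<lambda>j z. M j *v z + b j) (\<lambda>z. L *v z + c) sequentially"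
proof -
  have Aff: "(\<lambda>z. M j *v z + b j) \<in> Aff" "(\<lambda>z. L *v z + c) \<in> Aff" for j
    using assms by (auto simp: Aff_def)
  have "(\<lambda>j. (M j, b j)) \<longlonglongrightarrow> (L, c)" using assms by (intro tendsto_Pair)
  then have "\<forall>\<^sub>F j in sequentially. (M j, b j) \<in> S" if "open S" "(L, c) \<in> S" for S
    using that by (rule topological_tendstoD)
  then show ?thesis
    using Aff unfolding limitin_def topspace_Aff_topology
    by (auto simp: Aff_topology_def openin_pullback_topology aff_coords_affine)
qed

theorem proposition3p7:
  fixes \<Omega> :: "nat \<Rightarrow> (complex ^ 'd) set" and z :: "nat \<Rightarrow> complex ^ 'd"
    and A B :: "nat \<Rightarrow> complex ^ 'd \<Rightarrow> complex ^ 'd"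
    and U\<^sub>1 U\<^sub>2 :: "(complex ^ 'd) set" and u\<^sub>1 u\<^sub>2 :: "complex ^ 'd"
  assumes "\<And>n. (\<Omega> n, z n) \<in> XX0"
    and "\<And>n. A n \<in> Aff"
    and "\<And>n. B n \<in> Aff"
    and "tendsto_XX0 (\<lambda>n. aff_act (A n) (\<Omega> n, z n)) (U\<^sub>1, u\<^sub>1)"
    and "tendsto_XX0 (\<lambda>n. aff_act (B n) (\<Omega> n, z n)) (U\<^sub>2, u\<^sub>2)"
  shows "\<exists>(r :: nat \<Rightarrow> nat) T. filterlim r at_top sequentially \<and>
           limitin Aff_topology (\<lambda>j. B (r j) \<circ> inv (A (r j))) T sequentially \<and>
           T \<in> Aff \<and> aff_act T (U\<^sub>1, u\<^sub>1) = (U\<^sub>2, u\<^sub>2)"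
proof -
  define V W v w where "V n = A n ` \<Omega> n" and "W n = B n ` \<Omega> n" and "v n = A n (z n)" and "w n = B n (z n)" for n
  have V: "tendsto_XX V U\<^sub>1" "v \<longlonglongrightarrow> u\<^sub>1" "u\<^sub>1 \<in> U\<^sub>1" and W: "tendsto_XX W U\<^sub>2" "w \<longlonglongrightarrow> u\<^sub>2" "u\<^sub>2 \<in> U\<^sub>2"
    using assms(4,5)
    by (simp_all add: tendsto_XX0_def aff_act_def XX0_def V_def[abs_def] W_def[abs_def] v_def[abs_def] w_def[abs_def])
  have "\<exists>P P' p. P' ** P = mat 1 \<and> P ** P' = mat 1 \<and> A n = (\<lambda>x. P *v x + p)" for n
    using assms(2)[of n] by (auto simp: Aff_def invertible_def)
  then obtain P P' p where P: "\<And>n. P' n ** P n = mat 1" "\<And>n. P n ** P' n = mat 1"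
      and A: "\<And>n. A n = (\<lambda>x. P n *v x + p n)"
    by metis
  have "\<exists>Q Q' q. Q' ** Q = mat 1 \<and> Q ** Q' = mat 1 \<and> B n = (\<lambda>x. Q *v x + q)" for n
    using assms(3)[of n] by (auto simp: Aff_def invertible_def)
  then obtain Q Q' q where Q: "\<And>n. Q' n ** Q n = mat 1" "\<And>n. Q n ** Q' n = mat 1"
      and B: "\<And>n. B n = (\<lambda>x. Q n *v x + q n)"
    by metis
  define M N where "M n = Q n ** P' n" and "N n = P n ** Q' n" for n
  have MN: "M n ** N n = mat 1" "N n ** M n = mat 1" for n
  proof -
    have "M n ** N n = Q n ** (P' n ** P n) ** Q' n" by (simp only: M_def N_def matrix_mul_assoc)
    then show "M n ** N n = mat 1" by (simp add: P Q)
    have "N n ** M n = P n ** (Q' n ** Q n) ** P' n" by (simp only: M_def N_def matrix_mul_assoc)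
    then show "N n ** M n = mat 1" by (simp add: P Q)
  qed
  have MP: "M n ** P n = Q n" and NQ: "N n ** Q n = P n" for n
    by (simp_all add: M_def N_def P Q flip: matrix_mul_assoc)
  have MA: "w n + M n *v (A n x - v n) = B n x" for n x
    by (simp add: A B v_def w_def matrix_vector_mult_diff_distrib matrix_vector_mul_assoc MP)
  have NB: "v n + N n *v (B n x - w n) = A n x" for n x
    by (simp add: A B v_def w_def matrix_vector_mult_diff_distrib matrix_vector_mul_assoc NQ)
  have mapsM: "w n + M n *v (x - v n) \<in> W n" if "x \<in> V n" for n x
    using that MA by (auto simp: V_def W_def)
  have mapsN: "v n + N n *v (y - w n) \<in> V n" if "y \<in> W n" for n y
    using that NB by (auto simp: V_def W_def)
  have invA: "inv (A n) = (\<lambda>y. P' n *v (y - p n))" for n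
    by (rule inv_unique_comp)
      (auto simp: A fun_eq_iff matrix_vector_mul_assoc P matrix_vector_mult_diff_distrib matrix_vector_right_distrib)
  have T: "B n \<circ> inv (A n) = (\<lambda>y. M n *v y + (w n - M n *v v n))" for n
  proof
    fix y
    have "A n (inv (A n) y) = y" by (simp add: invA) (simp add: A matrix_vector_mul_assoc P)
    then show "(B n \<circ> inv (A n)) y = M n *v y + (w n - M n *v v n)"
      using MA[of n "inv (A n) y"] by (simp add: algebra_simps)
  qed
  obtain C N0 where C: "\<And>n x. n \<ge> N0 \<Longrightarrow> norm (M n *v x) \<le> C * norm x"
    using affine_maps_eventually_bounded[OF V(1) W(1) V(2,3) W(2,3) mapsM] by blast
  obtain D N1 where D: "\<And>n x. n \<ge> N1 \<Longrightarrow> norm (N n *v x) \<le> D * norm x"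
    using affine_maps_eventually_bounded[OF W(1) V(1) W(2,3) V(2,3) mapsN] by blast
  define K where "K = max N0 N1"
  have "bounded (range (\<lambda>n. M (n + K)))" "bounded (range (\<lambda>n. N (n + K)))"
    by (rule boundedI[where B = "CARD('d) * (CARD('d) * C)"],
        use norm_matrix_le[OF C] in \<open>auto simp: K_def\<close>)
      (rule boundedI[where B = "CARD('d) * (CARD('d) * D)"],
        use norm_matrix_le[OF D] in \<open>auto simp: K_def\<close>)
  then have "bounded (range (\<lambda>n. (M (n + K), N (n + K))))"
    by (rule bounded_subset[OF bounded_Times]) auto
  then obtain \<rho> l where \<rho>: "strict_mono \<rho>" and lim: "((\<lambda>n. (M (n + K), N (n + K))) \<circ> \<rho>) \<longlonglongrightarrow> l"
    using bounded_imp_convergent_subsequence by blast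
  define r where "r j = \<rho> j + K" for j
  have r: "filterlim r at_top sequentially"
    by (rule filterlim_at_top_mono[OF filterlim_subseq[OF \<rho>]]) (simp add: r_def)
  define L L' where "L = fst l" and "L' = snd l"
  have limM: "(\<lambda>j. M (r j)) \<longlonglongrightarrow> L" and limN: "(\<lambda>j. N (r j)) \<longlonglongrightarrow> L'"
    using tendsto_fst[OF lim] tendsto_snd[OF lim] by (simp_all add: r_def L_def L'_def comp_def)
  have "(\<lambda>j. M (r j) ** N (r j)) \<longlonglongrightarrow> L ** L'" "(\<lambda>j. N (r j) ** M (r j)) \<longlonglongrightarrow> L' ** L"
    by (intro tendsto_intros limM limN)+
  then have LL: "L ** L' = mat 1" "L' ** L = mat 1"
    by (simp_all add: MN LIMSEQ_const_iff)
  define T where "T x = L *v x + (u\<^sub>2 - L *v u\<^sub>1)" for x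
  have T': "T = (\<lambda>x. u\<^sub>2 + L *v (x - u\<^sub>1))"
    by (simp add: T_def fun_eq_iff matrix_vector_mult_diff_distrib)
  have "limitin Aff_topology (\<lambda>j y. M (r j) *v y + (w (r j) - M (r j) *v v (r j))) T sequentially"
    unfolding T_def[abs_def]
    using MN LL limM filterlim_compose[OF V(2) r] filterlim_compose[OF W(2) r]
    by (intro limitin_Aff_topology) (auto simp: invertible_def intro!: tendsto_intros)
  then have lim: "limitin Aff_topology (\<lambda>j. B (r j) \<circ> inv (A (r j))) T sequentially"
    by (simp only: T)
  have "T \<in> Aff"
    using limitin_topspace[OF lim] by (simp add: topspace_Aff_topology)
  have "T ` U\<^sub>1 \<subseteq> U\<^sub>2"
    unfolding T' using limit_affine_map_image_subset[OF V(1) W(1) r V(2) W(2) mapsM limM LL(2,1)] .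
  moreover have "U\<^sub>2 \<subseteq> T ` U\<^sub>1"
  proof
    fix y assume "y \<in> U\<^sub>2"
    then have "u\<^sub>1 + L' *v (y - u\<^sub>2) \<in> U\<^sub>1"
      using limit_affine_map_image_subset[OF W(1) V(1) r W(2) V(2) mapsN limN LL] by blast
    moreover have "y = T (u\<^sub>1 + L' *v (y - u\<^sub>2))"
      by (simp add: T' matrix_vector_mul_assoc LL)
    ultimately show "y \<in> T ` U\<^sub>1" by blast
  qed
  ultimately have "aff_act T (U\<^sub>1, u\<^sub>1) = (U\<^sub>2, u\<^sub>2)"
    by (auto simp: aff_act_def T')
  then show ?thesis using r lim \<open>T \<in> Aff\<close> by blast
qed

end
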